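(* Let $n$ and $k$ be nonnegative integers. Let $\mathrm{ped}(n,k)$ be the number of partitions of $n$ in which the even parts are distinct (odd parts are unrestricted) and exactly $k$ parts are even. Let $B(n,k)$ be the number of bicolored partitions $\lambda\in\mathscr{B}(n)$ having exactly $k$ red parts, where $\mathscr{B}(n)$ is as defined in the context. Then $$\mathrm{ped}(n,k)=B(n,k).$$
   Context: A partition of a nonnegative integer $n$ is a finite multiset of positive integers (parts) with sum $n$; the empty partition is the unique partition of $0$. A bicolored partition of $n$ is a partition of $n$ in which each part is colored blue or red; a blue part of size $c$ is written $c_b$ and a red part of size $c$ is written $c_r$. $\mathscr{B}(n)$ is the set of bicolored partitions of $n$ such that: (a) neither blue nor red parts repeat (each $c_b$ and each $c_r$ occurs at most once; $c_b$ and $c_r$ may both occur); (b) when going through the parts from the smallest to the largest, for each red part $c_r$ there must be a blue part $c_b$ or a blue part $(c+1)_b$, and these blue parts should be different for different red parts; that is, there is an injective assignment sending each red part $c_r$ of the partition to a blue part of the partition equal to $c_b$ or $(c+1)_b$. For example, the elements of $\mathscr{B}(4)$ are $4_b$, $3_b+1_b$, $2_b+2_r$, $2_b+1_b+1_r$. *)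

theory Defs
  imports "HOL-Library.Multiset"
begin

definition partitions :: "nat \<Rightarrow> nat multiset set" where
  "partitions n = {p. (\<forall>c \<in># p. c > 0) \<and> \<Sum>\<^sub># p = n}"

definition ped_partitions :: "nat \<Rightarrow> nat \<Rightarrow> nat multiset set" where
  "ped_partitions n k = {p \<in> partitions n.
     (\<forall>c. even c \<longrightarrow> count p c \<le> 1) \<and> size (filter_mset even p) = k}"

definition ped :: "nat \<Rightarrow> nat \<Rightarrow> nat" where
  "ped n k = card (ped_partitions n k)"

datatype color = Blue | Red

text \<open>A colored part is a pair of its size and its color.\<close>

definition bicolored_partitions :: "nat \<Rightarrow> (nat \<times> color) multiset set" where
  "bicolored_partitions n = {p. image_mset fst p \<in> partitions n}"

text \<open>In the second condition the red parts are identified with their sizes, and likewise the blue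
  parts; this loses nothing because by the first condition no colored part repeats.\<close>

definition \<B> :: "nat \<Rightarrow> (nat \<times> color) multiset set" where
  "\<B> n = {p \<in> bicolored_partitions n.
     (\<forall>x. count p x \<le> 1) \<and>
     (\<exists>f. inj_on f {c. (c, Red) \<in># p} \<and>
       (\<forall>c. (c, Red) \<in># p \<longrightarrow> (f c, Blue) \<in># p \<and> (f c = c \<or> f c = c + 1)))}"

definition B_partitions :: "nat \<Rightarrow> nat \<Rightarrow> (nat \<times> color) multiset set" where
  "B_partitions n k = {p \<in> \<B> n. size (filter_mset (\<lambda>x. snd x = Red) p) = k}"

definition B :: "nat \<Rightarrow> nat \<Rightarrow> nat" where
  "B n k = card (B_partitions n k)"

text \<open>Both counted sets are finite, so the cardinalities above are genuine counts.\<close>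

lemma finite_bounded_multisets:
  assumes "finite A"
  shows "finite {p. set_mset p \<subseteq> A \<and> size p \<le> n}"
proof (rule finite_subset)
  show "{p. set_mset p \<subseteq> A \<and> size p \<le> n} \<subseteq> (\<Union>m\<le>n. multisets_of_size A m)"
    by (auto simp: multisets_of_size_def)
  show "finite (\<Union>m\<le>n. multisets_of_size A m)"
    using assms by (simp add: finite_multisets_of_size)
qed

lemma partitions_subset:
  "partitions n \<subseteq> {p. set_mset p \<subseteq> {..n} \<and> size p \<le> n}"
proof
  fix p assume p: "p \<in> partitions n"
  have "size q \<le> \<Sum>\<^sub># q" if "\<forall>c \<in># q. 0 < c" for q :: "nat multiset"
    using that by (induction q) (simp, simp add: Suc_le_eq add_less_le_mono)
  moreover have "c \<le> n" if "c \<in># p" for c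
    using p multi_member_split[OF that] by (auto simp: partitions_def)
  ultimately show "p \<in> {p. set_mset p \<subseteq> {..n} \<and> size p \<le> n}"
    using p by (auto simp: partitions_def)
qed

lemma finite_partitions: "finite (partitions n)"
  by (rule finite_subset[OF partitions_subset]) (simp add: finite_bounded_multisets)

lemma finite_bicolored_partitions: "finite (bicolored_partitions n)"
proof (rule finite_subset)
  let ?A = "{..n} \<times> {Blue, Red}"
  show "finite {p. set_mset p \<subseteq> ?A \<and> size p \<le> n}"
    by (rule finite_bounded_multisets) simp
  show "bicolored_partitions n \<subseteq> {p. set_mset p \<subseteq> ?A \<and> size p \<le> n}"
  proof
    fix p assume "p \<in> bicolored_partitions n"
    then have "image_mset fst p \<in> {p. set_mset p \<subseteq> {..n} \<and> size p \<le> n}"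
      using partitions_subset[of n] unfolding bicolored_partitions_def by blast
    then have *: "fst ` set_mset p \<subseteq> {..n}" "size p \<le> n"
      by auto
    have "x \<in> ?A" if "x \<in># p" for x
      using that *(1) by (cases x; cases "snd x") auto
    then show "p \<in> {p. set_mset p \<subseteq> ?A \<and> size p \<le> n}"
      using *(2) by auto
  qed
qed

lemma finite_ped_partitions: "finite (ped_partitions n k)"
  unfolding ped_partitions_def using finite_partitions by simp

lemma finite_B_partitions: "finite (B_partitions n k)"
  unfolding B_partitions_def \<B>_def using finite_bicolored_partitions by simp

end

theory Submission
  imports Defs "HOL-Computational_Algebra.Formal_Power_Series"
begin

text \<open>
  Fix the number \<open>k\<close> of red parts and write \<open>D\<^sub>c = \<Prod>\<^bsub>i\<ge>c\<^esub> (1 + q\<^sup>i)\<close>. Removing the parts of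
  size \<open>c\<close> gives a recursion for the generating function of the pairs (blue set, red set) with all
  parts at least \<open>c\<close>, and its solution is
  \<open>q^(k (k - 1) + 2 k c) D\<^bsub>k+c\<^esub> / ((1 - q) \<dots> (1 - q^k))\<close>. In the same way, the partitions
  with \<open>k\<close> even parts, these being distinct, and all parts at least \<open>2 c + 1\<close> have the generating function
  \<open>q^(k (k - 1) + 2 k (c + 1)) / ((1 - q\<^sup>2) \<dots> (1 - q^(2 k)))\<close> times that of the
  partitions into odd parts at least \<open>2 c + 1\<close>; for \<open>c = 0\<close> the last factor is \<open>D\<^sub>1\<close> by Euler's identity.
  Since \<open>D\<^sub>1 = (1 + q) \<dots> (1 + q^k) D\<^bsub>k+1\<^esub>\<close>, the two series agree when all parts are at least 1.
\<close>

section \<open>Power series modulo powers of X\<close>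

lemma fps_X_power_dvd_iff:
  fixes f :: "'a :: idom fps"
  shows "fps_X ^ n dvd f \<longleftrightarrow> (\<forall>i<n. fps_nth f i = 0)"
proof
  assume "fps_X ^ n dvd f"
  then show "\<forall>i<n. fps_nth f i = 0"
    by (auto simp: dvd_def fps_X_power_mult_nth)
next
  assume *: "\<forall>i<n. fps_nth f i = 0"
  have "f = fps_X ^ n * fps_shift n f"
    using * by (intro fps_ext) (auto simp: fps_X_power_mult_nth)
  then show "fps_X ^ n dvd f" by (rule dvdI)
qed

text \<open>Over an integral domain the lowest coefficient of \<open>f * g\<close> is the constant
  term of \<open>f\<close> times the lowest coefficient of \<open>g\<close>, so multiplying by
  \<open>f\<close> keeps the subdegree.\<close>

lemma fps_X_power_dvd_mult_cancel:
  fixes f g :: "'a :: idom fps"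
  assumes "fps_nth f 0 \<noteq> 0" "fps_X ^ n dvd f * g"
  shows "fps_X ^ n dvd g"
proof (cases "g = 0")
  case False
  have "f \<noteq> 0" "subdegree f = 0" using assms(1) by auto
  then have "fps_nth (f * g) (subdegree g) \<noteq> 0"
    using False assms(1)
    by (metis add_0 mult_eq_0_iff nth_subdegree_mult nth_subdegree_nonzero)
  then have "n \<le> subdegree g"
    using assms(2) by (auto simp: fps_X_power_dvd_iff not_le[symmetric])
  then show ?thesis
    by (auto simp: fps_X_power_dvd_iff nth_less_subdegree_zero)
qed simp

text \<open>Uniqueness for a recursion in \<open>c\<close> whose initial condition sits at \<open>c \<rightarrow> \<infinity>\<close>: the recursion carries
  agreement modulo \<open>X^(c + n)\<close> from \<open>c + n\<close> down to \<open>c\<close>.\<close>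

lemma fps_sequence_eqI:
  fixes f g :: "nat \<Rightarrow> 'a :: idom fps"
  assumes step: "\<And>c. u c * (f c - g c) = v c * (f (Suc c) - g (Suc c))"
    and unit: "\<And>c. fps_nth (u c) 0 \<noteq> 0"
    and small: "\<And>c. fps_X ^ c dvd f c - g c"
  shows "f c = g c"
proof -
  have *: "fps_X ^ (c + n) dvd f c - g c" for n c
  proof (induction n arbitrary: c)
    case (Suc n)
    have "fps_X ^ (c + Suc n) dvd u c * (f c - g c)"
      using Suc[of "Suc c"] by (simp add: step)
    then show ?case using unit fps_X_power_dvd_mult_cancel by blast
  qed (simp add: small)
  have "fps_nth (f c - g c) i = 0" for i
    using *[of c "Suc i"] unfolding fps_X_power_dvd_iff by simp
  then show ?thesis by (simp add: fps_eq_iff)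
qed

section \<open>Generating functions of weighted sets\<close>

definition weight_fps :: "('a \<Rightarrow> nat) \<Rightarrow> 'a set \<Rightarrow> int fps" where
  "weight_fps w S = Abs_fps (\<lambda>n. int (card {x \<in> S. w x = n}))"

lemma weight_fps_empty [simp]: "weight_fps w {} = 0"
  by (simp add: weight_fps_def fps_eq_iff)

lemma weight_fps_Un:
  assumes "S \<inter> T = {}" "\<And>n. finite {x \<in> S \<union> T. w x = n}"
  shows "weight_fps w (S \<union> T) = weight_fps w S + weight_fps w T"
proof (rule fps_ext)
  fix n
  have "{x \<in> S \<union> T. w x = n} = {x \<in> S. w x = n} \<union> {x \<in> T. w x = n}" by auto
  moreover have "finite {x \<in> S. w x = n}" "finite {x \<in> T. w x = n}"
    using assms(2)[of n] by (auto elim: finite_subset[rotated])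
  ultimately show "fps_nth (weight_fps w (S \<union> T)) n = fps_nth (weight_fps w S + weight_fps w T) n"
    using assms(1) by (simp add: weight_fps_def card_Un_disjoint disjoint_iff)
qed

lemma weight_fps_image:
  assumes "inj_on f S" "\<And>x. x \<in> S \<Longrightarrow> w (f x) = w x + s"
  shows "weight_fps w (f ` S) = fps_X ^ s * weight_fps w S"
proof (rule fps_ext)
  fix n
  have "card {x \<in> f ` S. w x = n} = card {x \<in> S. w x + s = n}"
  proof -
    have "{x \<in> f ` S. w x = n} = f ` {x \<in> S. w x + s = n}" using assms(2) by auto
    then show ?thesis
      by (simp add: card_image inj_on_subset[OF assms(1)])
  qed
  also have "\<dots> = (if n < s then 0 else card {x \<in> S. w x = n - s})"
  proof -
    have "{x \<in> S. w x + s = n} = (if n < s then {} else {x \<in> S. w x = n - s})" by auto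
    then show ?thesis by simp
  qed
  finally show "fps_nth (weight_fps w (f ` S)) n = fps_nth (fps_X ^ s * weight_fps w S) n"
    by (simp add: weight_fps_def fps_X_power_mult_nth)
qed

lemma fps_X_power_dvd_weight_fps:
  assumes "\<And>x. x \<in> S \<Longrightarrow> c \<le> w x"
  shows "fps_X ^ c dvd weight_fps w S"
proof -
  have "{x \<in> S. w x = i} = {}" if "i < c" for i using assms that by force
  then show ?thesis
    unfolding fps_X_power_dvd_iff weight_fps_def by (metis card.empty fps_nth_Abs_fps of_nat_0)
qed

section \<open>Matching red sizes with blue sizes\<close>

definition matchable :: "nat set \<Rightarrow> nat set \<Rightarrow> bool" where
  "matchable b r \<longleftrightarrow> (\<exists>f. inj_on f r \<and> (\<forall>c\<in>r. f c \<in> b \<and> (f c = c \<or> f c = c + 1)))"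

text \<open>A red size above \<open>c\<close> can only use blue sizes above \<open>c\<close>, so a
  blue \<open>c\<close> cannot serve it.\<close>

lemma matchable_insert_blue:
  assumes "r \<subseteq> {Suc c..}"
  shows "matchable (insert c b) r \<longleftrightarrow> matchable b r"
  using assms unfolding matchable_def by (intro ex_cong) fastforce

text \<open>Greedy choice: no red size above \<open>c\<close> can use the blue \<open>c\<close>, so
  the red \<open>c\<close> takes it at no cost.\<close>

lemma matchable_insert_both:
  assumes "b \<subseteq> {Suc c..}" "r \<subseteq> {Suc c..}"
  shows "matchable (insert c b) (insert c r) \<longleftrightarrow> matchable b r"
proof
  assume "matchable (insert c b) (insert c r)"
  then have "matchable (insert c b) r"
    unfolding matchable_def by (blast intro: inj_on_subset)
  then show "matchable b r" using assms(2) by (simp add: matchable_insert_blue)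
next
  assume "matchable b r"
  then obtain f where f: "inj_on f r" "\<forall>x\<in>r. f x \<in> b \<and> (f x = x \<or> f x = x + 1)"
    by (auto simp: matchable_def)
  have "c \<notin> r" using assms(2) by auto
  then have "inj_on (f(c := c)) (insert c r)"
    using f assms by (fastforce simp: inj_on_def)
  moreover have "\<forall>x\<in>insert c r. (f(c := c)) x \<in> insert c b \<and> ((f(c := c)) x = x \<or> (f(c := c)) x = x + 1)"
    using f by auto
  ultimately show "matchable (insert c b) (insert c r)"
    unfolding matchable_def by blast
qed

text \<open>With no blue \<open>c\<close> available, the red \<open>c\<close> is forced onto the
  blue \<open>Suc c\<close>, which is then lost to the other red sizes.\<close>

lemma matchable_insert_red:
  assumes "b \<subseteq> {Suc c..}" "r \<subseteq> {Suc c..}"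
  shows "matchable b (insert c r) \<longleftrightarrow> Suc c \<in> b \<and> matchable (b - {Suc c}) r"
proof
  assume "matchable b (insert c r)"
  then obtain f where f: "inj_on f (insert c r)"
    "\<forall>x\<in>insert c r. f x \<in> b \<and> (f x = x \<or> f x = x + 1)"
    by (auto simp: matchable_def)
  then have c: "f c = Suc c" "Suc c \<in> b" using assms(1) by force+
  have "f x \<noteq> Suc c" if "x \<in> r" for x
    using f(1) that c assms(2) by (metis atLeast_iff inj_onD insertCI not_less_eq_eq order_refl subsetD)
  then have "\<forall>x\<in>r. f x \<in> b - {Suc c} \<and> (f x = x \<or> f x = x + 1)" using f(2) by auto
  with f(1) c(2) show "Suc c \<in> b \<and> matchable (b - {Suc c}) r"
    unfolding matchable_def by (blast intro: inj_on_subset)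
next
  assume *: "Suc c \<in> b \<and> matchable (b - {Suc c}) r"
  then obtain f where f: "inj_on f r" "\<forall>x\<in>r. f x \<in> b - {Suc c} \<and> (f x = x \<or> f x = x + 1)"
    by (auto simp: matchable_def)
  have "c \<notin> r" using assms(2) by auto
  then have "inj_on (f(c := Suc c)) (insert c r)"
    using f by (auto simp: inj_on_def)
  moreover have "\<forall>x\<in>insert c r. (f(c := Suc c)) x \<in> b \<and> ((f(c := Suc c)) x = x \<or> (f(c := Suc c)) x = x + 1)"
    using f * by auto
  ultimately show "matchable b (insert c r)"
    unfolding matchable_def by blast
qed

text \<open>Scanning the part sizes upwards, only \<open>u = v\<close> and \<open>u = v + 1\<close> occur; the second case arises when the blue part \<open>v\<close> is absent, so
  that a red part \<open>v\<close> must use the blue part \<open>v + 1\<close>.\<close>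

definition matched_pairs :: "nat \<Rightarrow> nat \<Rightarrow> nat \<Rightarrow> (nat set \<times> nat set) set" where
  "matched_pairs u v k = {(b, r). finite b \<and> finite r \<and> b \<subseteq> {u..} \<and> r \<subseteq> {v..} \<and>
     card r = k \<and> matchable b r}"

definition pair_weight :: "nat set \<times> nat set \<Rightarrow> nat" where
  "pair_weight = (\<lambda>(b, r). \<Sum>b + \<Sum>r)"

abbreviation matched_fps :: "nat \<Rightarrow> nat \<Rightarrow> nat \<Rightarrow> int fps" where
  "matched_fps u v k \<equiv> weight_fps pair_weight (matched_pairs u v k)"

lemma le_Sum_nat: "finite A \<Longrightarrow> x \<in> A \<Longrightarrow> x \<le> \<Sum>A" for x :: nat
  by (rule member_le_sum) auto

lemma finite_matched_pairs: "finite {x \<in> matched_pairs u v k. pair_weight x = n}"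
proof (rule finite_subset)
  show "{x \<in> matched_pairs u v k. pair_weight x = n} \<subseteq> Pow {..n} \<times> Pow {..n}"
    unfolding matched_pairs_def pair_weight_def by (auto dest: le_Sum_nat)
qed simp

section \<open>Decomposing matched pairs by their smallest size\<close>

lemma matched_pairs_mono:
  "u \<ge> u' \<Longrightarrow> v \<ge> v' \<Longrightarrow> matched_pairs u v k \<subseteq> matched_pairs u' v' k"
  unfolding matched_pairs_def by auto

lemma subset_atLeast_Suc_iff: "A \<subseteq> {Suc c..} \<longleftrightarrow> A \<subseteq> {c..} \<and> c \<notin> A"
  by (auto simp: subset_iff Suc_le_eq) (metis le_neq_implies_less)

lemma subset_atLeast_Suc: "A \<subseteq> {c..} \<Longrightarrow> c \<notin> A \<Longrightarrow> A \<subseteq> {Suc c..}"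
  by (simp add: subset_atLeast_Suc_iff)

lemma matched_pairs_red_0: "matched_pairs u v 0 = matched_pairs u v' 0"
  unfolding matched_pairs_def by auto

definition insert_blue :: "nat \<Rightarrow> nat set \<times> nat set \<Rightarrow> nat set \<times> nat set" where
  "insert_blue c = (\<lambda>(b, r). (insert c b, r))"

definition insert_red :: "nat \<Rightarrow> nat set \<times> nat set \<Rightarrow> nat set \<times> nat set" where
  "insert_red c = (\<lambda>(b, r). (b, insert c r))"

text \<open>Split by whether the red \<open>c\<close> is present. If it is, it uses up the blue
  \<open>Suc c\<close>; removing both raises both bounds by one and keeps the shape
  \<open>u = v + 1\<close>.\<close>

lemma matched_pairs_red_step:
  "matched_pairs (Suc c) c (Suc j) = matched_pairs (Suc c) (Suc c) (Suc j) \<union>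
     (insert_blue (Suc c) \<circ> insert_red c) ` matched_pairs (Suc (Suc c)) (Suc c) j"
  (is "?L = ?R1 \<union> ?R2")
proof
  show "?L \<subseteq> ?R1 \<union> ?R2"
  proof (clarify)
    fix b r assume L: "(b, r) \<in> ?L" and n: "(b, r) \<notin> ?R2"
    show "(b, r) \<in> ?R1"
    proof (cases "c \<in> r")
      case False
      then show ?thesis using L subset_atLeast_Suc unfolding matched_pairs_def by auto
    next
      case True
      define r' where "r' = r - {c}"
      have r: "r = insert c r'" "c \<notin> r'" using True by (auto simp: r'_def)
      have "r' \<subseteq> {Suc c..}" using L r by (intro subset_atLeast_Suc) (auto simp: matched_pairs_def)
      moreover have "Suc c \<in> b \<and> matchable (b - {Suc c}) r'"
        using L r calculation matchable_insert_red[of b c r'] by (auto simp: matched_pairs_def)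
      moreover have "b - {Suc c} \<subseteq> {Suc (Suc c)..}"
        using L by (intro subset_atLeast_Suc) (auto simp: matched_pairs_def)
      ultimately have "(b - {Suc c}, r') \<in> matched_pairs (Suc (Suc c)) (Suc c) j"
        using L r by (auto simp: matched_pairs_def)
      moreover have "(b, r) = (insert_blue (Suc c) \<circ> insert_red c) (b - {Suc c}, r')"
        using \<open>Suc c \<in> b \<and> _\<close> r by (auto simp: insert_blue_def insert_red_def)
      ultimately show ?thesis using n by blast
    qed
  qed
  have "(insert_blue (Suc c) \<circ> insert_red c) x \<in> ?L"
    if "x \<in> matched_pairs (Suc (Suc c)) (Suc c) j" for x
  proof -
    obtain b r where x: "x = (b, r)" by force
    have h: "finite b" "finite r" "b \<subseteq> {Suc (Suc c)..}" "r \<subseteq> {Suc c..}" "card r = j" "matchable b r"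
      using that x by (auto simp: matched_pairs_def)
    then have "Suc c \<notin> b" "c \<notin> r" "insert (Suc c) b \<subseteq> {Suc c..}" by auto
    moreover from this have "matchable (insert (Suc c) b) (insert c r)"
      using h by (subst matchable_insert_red) auto
    ultimately show ?thesis
      using h by (auto simp: x matched_pairs_def insert_blue_def insert_red_def)
  qed
  then show "?R1 \<union> ?R2 \<subseteq> ?L" 
    using matched_pairs_mono[of "Suc c" "Suc c" c "Suc c" "Suc j"]
    by (intro Un_least image_subsetI) auto
qed


text \<open>This and the next two lemmas treat the three cases for size \<open>c\<close>: blue
  alone, both colors, no blue.\<close>

lemma matched_pairs_blue:
  "{x \<in> matched_pairs c c k. c \<in> fst x \<and> c \<notin> snd x} =
     insert_blue c ` matched_pairs (Suc c) (Suc c) k" (is "?L = ?R")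
proof
  show "?L \<subseteq> ?R"
  proof clarify
    fix b r assume L: "(b, r) \<in> matched_pairs c c k" "c \<in> fst (b, r)" "c \<notin> snd (b, r)"
    have "b - {c} \<subseteq> {Suc c..}" and r: "r \<subseteq> {Suc c..}"
      using L by (auto simp: matched_pairs_def subset_atLeast_Suc_iff)
    moreover have "matchable (b - {c}) r"
      using L r matchable_insert_blue[of r c "b - {c}"] by (auto simp: matched_pairs_def insert_absorb)
    ultimately have "(b - {c}, r) \<in> matched_pairs (Suc c) (Suc c) k"
      using L by (auto simp: matched_pairs_def)
    moreover have "(b, r) = insert_blue c (b - {c}, r)" using L by (auto simp: insert_blue_def)
    ultimately show "(b, r) \<in> ?R" by blast
  qed
  show "?R \<subseteq> ?L"
    by (auto simp: matched_pairs_def insert_blue_def matchable_insert_blue)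
qed

lemma matched_pairs_both:
  "{x \<in> matched_pairs c c (Suc j). c \<in> fst x \<and> c \<in> snd x} =
     (insert_blue c \<circ> insert_red c) ` matched_pairs (Suc c) (Suc c) j" (is "?L = ?R")
proof
  show "?L \<subseteq> ?R"
  proof clarify
    fix b r assume L: "(b, r) \<in> matched_pairs c c (Suc j)" "c \<in> fst (b, r)" "c \<in> snd (b, r)"
    have "b - {c} \<subseteq> {Suc c..}" "r - {c} \<subseteq> {Suc c..}"
      using L by (auto intro!: subset_atLeast_Suc simp: matched_pairs_def)
    moreover from this have "matchable (b - {c}) (r - {c})"
      using L matchable_insert_both[of "b - {c}" c "r - {c}"]
      by (auto simp: matched_pairs_def insert_absorb)
    ultimately have "(b - {c}, r - {c}) \<in> matched_pairs (Suc c) (Suc c) j"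
      using L by (auto simp: matched_pairs_def)
    moreover have "(b, r) = (insert_blue c \<circ> insert_red c) (b - {c}, r - {c})"
      using L by (auto simp: insert_blue_def insert_red_def)
    ultimately show "(b, r) \<in> ?R" by blast
  qed
  have "(insert_blue c \<circ> insert_red c) x \<in> ?L" if "x \<in> matched_pairs (Suc c) (Suc c) j" for x
  proof -
    obtain b r where x: "x = (b, r)" by force
    have h: "finite b" "finite r" "b \<subseteq> {Suc c..}" "r \<subseteq> {Suc c..}" "card r = j" "matchable b r"
      using that x by (auto simp: matched_pairs_def)
    then have "c \<notin> r" by auto
    then show ?thesis
      using h by (auto simp: x matched_pairs_def insert_blue_def insert_red_def matchable_insert_both)
  qed
  then show "?R \<subseteq> ?L" by blast
qed

text \<open>The red bound is not raised, since a red \<open>c\<close> may remain; for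
  \<open>v = c\<close> this produces the shape \<open>u = v + 1\<close>.\<close>

lemma matched_pairs_no_blue:
  "{x \<in> matched_pairs c v k. c \<notin> fst x} = matched_pairs (Suc c) v k"
  by (auto simp: matched_pairs_def subset_atLeast_Suc_iff)

section \<open>Recursions for the series of matched pairs\<close>

lemma pair_weight_insert_blue:
  "finite b \<Longrightarrow> c \<notin> b \<Longrightarrow> pair_weight (insert_blue c (b, r)) = pair_weight (b, r) + c"
  by (auto simp: pair_weight_def insert_blue_def)

lemma inj_insert_blue: "inj_on (insert_blue c) (matched_pairs (Suc c) v k)"
  by (auto simp: inj_on_def insert_blue_def matched_pairs_def)
     (metis Suc_n_not_le_n atLeast_iff insert_ident subset_iff)+

lemma inj_insert_both:
  "inj_on (insert_blue c \<circ> insert_red d) (matched_pairs (Suc c) (Suc d) k)"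
proof (rule inj_onI, clarify)
  fix b r b' r'
  assume "(b, r) \<in> matched_pairs (Suc c) (Suc d) k" "(b', r') \<in> matched_pairs (Suc c) (Suc d) k"
    and eq: "(insert_blue c \<circ> insert_red d) (b, r) = (insert_blue c \<circ> insert_red d) (b', r')"
  then have "c \<notin> b" "c \<notin> b'" "d \<notin> r" "d \<notin> r'"
    by (auto simp: matched_pairs_def)
  with eq show "b = b' \<and> r = r'"
    by (simp add: insert_blue_def insert_red_def insert_ident)
qed

lemma weight_insert_blue:
  "weight_fps pair_weight (insert_blue c ` matched_pairs (Suc c) v k) =
     fps_X ^ c * matched_fps (Suc c) v k"
  by (rule weight_fps_image[OF inj_insert_blue])
     (auto simp: matched_pairs_def pair_weight_insert_blue subset_atLeast_Suc_iff)

lemma weight_insert_both: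
  "weight_fps pair_weight ((insert_blue c \<circ> insert_red d) ` matched_pairs (Suc c) (Suc d) k) =
     fps_X ^ (c + d) * matched_fps (Suc c) (Suc d) k"
proof (rule weight_fps_image[OF inj_insert_both], clarify)
  fix b r assume "(b, r) \<in> matched_pairs (Suc c) (Suc d) k"
  then have "finite b" "finite r" "c \<notin> b" "d \<notin> r" by (auto simp: matched_pairs_def)
  then show "pair_weight ((insert_blue c \<circ> insert_red d) (b, r)) = pair_weight (b, r) + (c + d)"
    by (simp add: pair_weight_def insert_blue_def insert_red_def)
qed

lemma matched_fps_red_step:
  "matched_fps (Suc c) c (Suc j) = matched_fps (Suc c) (Suc c) (Suc j) +
     fps_X ^ (2 * c + 1) * matched_fps (Suc (Suc c)) (Suc c) j"
proof -
  have "c \<notin> snd x" if "x \<in> matched_pairs (Suc c) (Suc c) (Suc j)" for x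
    using that by (auto simp: matched_pairs_def)
  moreover have "c \<in> snd ((insert_blue (Suc c) \<circ> insert_red c) x)" for x
    by (simp add: insert_blue_def insert_red_def case_prod_beta)
  ultimately have "matched_pairs (Suc c) (Suc c) (Suc j) \<inter>
    (insert_blue (Suc c) \<circ> insert_red c) ` matched_pairs (Suc (Suc c)) (Suc c) j = {}"
    by blast
  then show ?thesis
    using finite_matched_pairs[of "Suc c" c "Suc j"]
    by (simp add: matched_pairs_red_step weight_fps_Un weight_insert_both mult_2
        del: comp_apply image_comp)
qed

text \<open>The summands stand for no blue \<open>c\<close>, blue alone, and both colors; the last
  case removes a red part, so it is empty for \<open>k = 0\<close>.\<close>

lemma matched_fps_blue_step:
  "matched_fps c c k = matched_fps (Suc c) c k + fps_X ^ c * matched_fps (Suc c) (Suc c) k +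
     (case k of 0 \<Rightarrow> 0 | Suc j \<Rightarrow> fps_X ^ (2 * c) * matched_fps (Suc c) (Suc c) j)"
proof -
  define P where "P = matched_pairs c c k"
  define P1 P2 P3 where "P1 = {x \<in> P. c \<notin> fst x}" and "P2 = {x \<in> P. c \<in> fst x \<and> c \<notin> snd x}"
    and "P3 = {x \<in> P. c \<in> fst x \<and> c \<in> snd x}"
  have fin: "finite {x \<in> P. pair_weight x = n}" for n
    unfolding P_def by (rule finite_matched_pairs)
  have P: "P = (P1 \<union> P2) \<union> P3" and disj: "(P1 \<union> P2) \<inter> P3 = {}" "P1 \<inter> P2 = {}"
    by (auto simp: P1_def P2_def P3_def)
  have fin2: "finite {x \<in> P1 \<union> P2. pair_weight x = n}" for n
    by (rule finite_subset[OF _ fin[of n]]) (auto simp: P)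
  have "weight_fps pair_weight P = weight_fps pair_weight P1 + weight_fps pair_weight P2 +
    weight_fps pair_weight P3"
    using fin fin2 disj unfolding P by (simp add: weight_fps_Un)
  moreover have "weight_fps pair_weight P3 =
    (case k of 0 \<Rightarrow> 0 | Suc j \<Rightarrow> fps_X ^ (2 * c) * matched_fps (Suc c) (Suc c) j)"
  proof (cases k)
    case 0
    then have "P3 = {}" by (auto simp: P3_def P_def matched_pairs_def)
    then show ?thesis using 0 by simp
  next
    case (Suc j)
    then show ?thesis
      by (simp add: P3_def P_def matched_pairs_both weight_insert_both mult_2 del: comp_apply image_comp)
  qed
  ultimately show ?thesis
    by (simp add: P1_def P2_def P_def matched_pairs_no_blue matched_pairs_blue weight_insert_blue)
qed

section \<open>Closed form for matched pairs\<close>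

text \<open>This is D_c of the overview: without red parts every finite blue set is matchable, so
  finite sets of sizes at least \<open>c\<close> are counted.\<close>

definition distinct_fps :: "nat \<Rightarrow> int fps" where
  "distinct_fps c = matched_fps c c 0"

lemma distinct_fps_Suc: "distinct_fps c = (1 + fps_X ^ c) * distinct_fps (Suc c)"
  using matched_fps_blue_step[of c 0] matched_pairs_red_0[of "Suc c" c "Suc c"]
  by (simp add: distinct_fps_def algebra_simps)

text \<open>The q-Pochhammer symbol (q; q)_k at q = \<open>fps_X\<close>; the usual q-factorial is
  this divided by (1 - q)^k.\<close>

definition q_factorial :: "nat \<Rightarrow> int fps" where
  "q_factorial k = (\<Prod>i=1..k. 1 - fps_X ^ i)"

text \<open>Initial condition for \<open>fps_sequence_eqI\<close>: a single red part already weighs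
  at least \<open>c\<close>.\<close>

lemma fps_X_power_dvd_matched_fps: "fps_X ^ c dvd matched_fps c c (Suc j)"
proof (rule fps_X_power_dvd_weight_fps)
  fix x assume "x \<in> matched_pairs c c (Suc j)"
  then obtain b r where x: "x = (b, r)" "finite r" "r \<subseteq> {c..}" "card r = Suc j"
    by (auto simp: matched_pairs_def)
  then obtain y where "y \<in> r" by (metis card.empty equals0I nat.distinct(1))
  then have "c \<le> \<Sum>r" using le_Sum_nat[of r y] x by force
  then show "c \<le> pair_weight x" by (simp add: x pair_weight_def)
qed

text \<open>The exponents are the least weights: red sizes c, ..., c + k - 1 with equal blue sizes
  in the first case, with blue sizes one larger in the second. Both shapes are treated together
  because their recursions are intertwined; the terms with one red part fewer are known by induction
  on \<open>k\<close>, which leaves a recursion in \<open>c\<close>.\<close>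

lemma matched_fps_closed_form:
  "q_factorial k * matched_fps c c k = fps_X ^ (k * (k - 1) + 2 * k * c) * distinct_fps (k + c) \<and>
   q_factorial k * matched_fps (Suc c) c k = fps_X ^ (k * k + 2 * k * c) * distinct_fps (Suc (k + c))"
proof (induction k arbitrary: c)
  case 0
  show ?case
    using matched_pairs_red_0[of "Suc c" c "Suc c"] by (simp add: distinct_fps_def q_factorial_def)
next
  case (Suc j)
  \<comment> \<open>\<open>F\<close> and \<open>H\<close> are the left-hand sides, \<open>T\<close>
    and \<open>U\<close> the claimed right-hand sides. Expressing everything through
    \<open>a\<close>, \<open>x\<close>, \<open>y\<close> and \<open>E\<close> turns the verification
    into polynomial algebra.\<close>
  define F where "F c = q_factorial (Suc j) * matched_fps c c (Suc j)" for c
  define H where "H c = q_factorial (Suc j) * matched_fps (Suc c) c (Suc j)" for c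
  define T where "T c = fps_X ^ (Suc j * j + 2 * Suc j * c) * distinct_fps (Suc j + c)" for c
  define U where "U c = fps_X ^ (Suc j * Suc j + 2 * Suc j * c) * distinct_fps (Suc (Suc j + c))" for c
  define a where "a c = (fps_X :: int fps) ^ (Suc j * j + 2 * Suc j * c)" for c
  define x where "x = (fps_X :: int fps) ^ Suc j"
  define y where "y c = (fps_X :: int fps) ^ c" for c
  define E where "E c = distinct_fps (Suc (Suc (j + c)))" for c
  have qf: "q_factorial (Suc j) = (1 - x) * q_factorial j"
    by (simp add: q_factorial_def x_def)
  have h: "H c = F (Suc c) + (1 - x) * (a c * x * E c)" for c
  proof -
    have "H c = F (Suc c) + (1 - x) * (fps_X ^ (2 * c + 1) * (q_factorial j * matched_fps (Suc (Suc c)) (Suc c) j))"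
      unfolding H_def matched_fps_red_step F_def qf by (simp add: algebra_simps)
    also have "fps_X ^ (2 * c + 1) * (q_factorial j * matched_fps (Suc (Suc c)) (Suc c) j) = a c * x * E c"
      by (simp add: Suc a_def x_def E_def power_add[symmetric] mult.assoc[symmetric] del: power_Suc)
    finally show ?thesis .
  qed
  have f: "F c = H c + y c * F (Suc c) + (1 - x) * (a c * distinct_fps (Suc (j + c)))" for c
  proof -
    have "F c = H c + y c * F (Suc c) + (1 - x) * (fps_X ^ (2 * c) * (q_factorial j * matched_fps (Suc c) (Suc c) j))"
      unfolding H_def F_def qf y_def by (subst matched_fps_blue_step) (simp add: algebra_simps)
    also have "fps_X ^ (2 * c) * (q_factorial j * matched_fps (Suc c) (Suc c) j) = a c * distinct_fps (Suc (j + c))"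
    proof -
      \<comment> \<open>The case split on \<open>j\<close> handles the truncated subtraction
        \<open>j - 1\<close>.\<close>
      have "2 * c + (j * (j - 1) + 2 * j * Suc c) = Suc j * j + 2 * Suc j * c" 
        by (cases j) (auto simp: algebra_simps)
      then show ?thesis
        by (simp add: Suc a_def power_add[symmetric] mult.assoc[symmetric] del: power_Suc)
    qed
    finally show ?thesis .
  qed
  have D: "distinct_fps (Suc (j + c)) = (1 + x * y c) * E c" for c
    unfolding distinct_fps_Suc[of "Suc (j + c)"] by (simp add: E_def x_def y_def power_add mult.assoc)
  have T: "T c = a c * ((1 + x * y c) * E c)" and U: "U c = a c * x * E c"
    and T': "T (Suc c) = a c * x * x * E c" for c
  proof -
    show "T c = a c * ((1 + x * y c) * E c)" by (simp add: T_def a_def D)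
    show "U c = a c * x * E c"
      by (simp add: U_def a_def E_def x_def power_add[symmetric] del: power_Suc)
    show "T (Suc c) = a c * x * x * E c"
      by (simp add: T_def a_def E_def x_def power_add[symmetric] del: power_Suc)
  qed
  \<comment> \<open>Inserting \<open>h\<close> into \<open>f\<close> eliminates \<open>H\<close> and
    leaves a recursion from \<open>F (Suc c)\<close> to \<open>F c\<close> with factor
    \<open>1 + y c\<close>. \<open>T\<close> satisfies it too, because (1 + y) x^2 + (1 - x) (x + 1
    + x y) = 1 + x y.\<close>
  have FT: "F c = T c" for c
  proof (rule fps_sequence_eqI[where u = "\<lambda>_. 1" and v = "\<lambda>c. 1 + y c"])
    show "fps_X ^ c dvd F c - T c" for c
    proof (rule dvd_diff)
      show "fps_X ^ c dvd F c" unfolding F_def by (simp add: fps_X_power_dvd_matched_fps)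
      show "fps_X ^ c dvd T c" unfolding T_def by (intro dvd_mult2 le_imp_power_dvd) simp
    qed
    show "1 * (F c - T c) = (1 + y c) * (F (Suc c) - T (Suc c))" for c
      unfolding f[of c] h[of c] T[of c] T'[of c] D[of c] by (simp add: algebra_simps)
  qed simp
  have "H c = U c" unfolding h FT T' U by (simp add: algebra_simps)
  with FT[of c] show ?case unfolding F_def H_def T_def U_def by simp
qed

section \<open>Recursions for partitions with distinct even parts\<close>

definition ped_family :: "nat \<Rightarrow> nat \<Rightarrow> nat multiset set" where
  "ped_family m k = {p. (\<forall>c \<in># p. m \<le> c) \<and> (\<forall>c. even c \<longrightarrow> count p c \<le> 1) \<and>
     size (filter_mset even p) = k}"

abbreviation ped_fps :: "nat \<Rightarrow> nat \<Rightarrow> int fps" where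
  "ped_fps m k \<equiv> weight_fps sum_mset (ped_family m k)"

lemma finite_ped_family:
  assumes "m > 0"
  shows "finite {p \<in> ped_family m k. \<Sum>\<^sub># p = n}"
  by (rule finite_subset[OF _ finite_partitions[of n]])
     (use assms in \<open>force simp: ped_family_def partitions_def\<close>)

lemma ped_family_without:
  "{p \<in> ped_family m k. m \<notin># p} = ped_family (Suc m) k"
  by (auto simp: ped_family_def Suc_le_eq) (metis le_neq_implies_less)

text \<open>Odd sizes may repeat, so removing one copy stays in the same family; this yields the
  geometric factor 1 / (1 - X^m).\<close>

lemma ped_family_with_odd:
  assumes "odd m"
  shows "{p \<in> ped_family m k. m \<in># p} = add_mset m ` ped_family m k" (is "?L = ?R")
proof
  show "?L \<subseteq> ?R"
  proof
    fix p assume p: "p \<in> ?L"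
    then obtain q where q: "p = add_mset m q" by (auto dest: multi_member_split)
    have "q \<in> ped_family m k"
      using p assms by (auto simp: ped_family_def q split: if_splits)
    then show "p \<in> ?R" using q by blast
  qed
  show "?R \<subseteq> ?L" using assms by (auto simp: ped_family_def)
qed

text \<open>The even size \<open>m\<close> occurs at most once, so its removal raises the bound and
  costs one even part.\<close>

lemma ped_family_with_even:
  assumes "even m"
  shows "{p \<in> ped_family m (Suc j). m \<in># p} = add_mset m ` ped_family (Suc m) j" (is "?L = ?R")
proof
  show "?L \<subseteq> ?R"
  proof
    fix p assume p: "p \<in> ?L"
    then obtain q where q: "p = add_mset m q" by (auto dest: multi_member_split)
    have "count p m \<le> 1" using p assms by (auto simp: ped_family_def)
    then have "m \<notin># q" by (simp add: q not_in_iff)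
    moreover have "q \<in> ped_family m j"
    proof -
      have "count q c \<le> 1" if "even c" for c
        using p that \<open>m \<notin># q\<close> by (cases "c = m") (auto simp: ped_family_def q not_in_iff dest!: spec[of _ c])
      then show ?thesis using p assms by (auto simp: ped_family_def q)
    qed
    ultimately show "p \<in> ?R" using q ped_family_without by blast
  qed
  show "?R \<subseteq> ?L"
  proof (rule image_subsetI)
    fix q assume q: "q \<in> ped_family (Suc m) j"
    then have "m \<notin># q" by (auto simp: ped_family_def)
    then show "add_mset m q \<in> ?L"
      using q assms by (auto simp: ped_family_def not_in_iff Suc_leD)
  qed
qed

lemma ped_fps_split:
  assumes "m > 0"
  shows "ped_fps m k = ped_fps (Suc m) k + weight_fps sum_mset {p \<in> ped_family m k. m \<in># p}"
proof -
  have P: "ped_family m k = {p \<in> ped_family m k. m \<notin># p} \<union> {p \<in> ped_family m k. m \<in># p}"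
    by blast
  have "ped_fps m k = weight_fps sum_mset {p \<in> ped_family m k. m \<notin># p} +
    weight_fps sum_mset {p \<in> ped_family m k. m \<in># p}"
    by (subst P, rule weight_fps_Un) (use finite_ped_family[OF assms] in \<open>auto simp flip: P\<close>)
  then show ?thesis by (simp add: ped_family_without)
qed

lemma weight_add_mset:
  "weight_fps sum_mset (add_mset m ` S) = fps_X ^ m * weight_fps sum_mset S" for m :: nat
  by (rule weight_fps_image) (auto simp: inj_on_def)

lemma ped_fps_odd:
  assumes "odd m"
  shows "(1 - fps_X ^ m) * ped_fps m k = ped_fps (Suc m) k"
  using ped_fps_split[of m k] assms
  by (simp add: ped_family_with_odd weight_add_mset algebra_simps odd_pos)

lemma ped_fps_even:
  assumes "even m" "m > 0"
  shows "ped_fps m k = ped_fps (Suc m) k +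
    (case k of 0 \<Rightarrow> 0 | Suc j \<Rightarrow> fps_X ^ m * ped_fps (Suc m) j)"
proof (cases k)
  case 0
  have empty: "{p \<in> ped_family m 0. m \<in># p} = {}"
    using assms(1) by (fastforce simp: ped_family_def dest: multi_member_split)
  then show ?thesis using ped_fps_split[OF assms(2), of 0] 0
    unfolding empty by simp
next
  case (Suc j)
  then show ?thesis using ped_fps_split[OF assms(2), of k] assms(1)
    by (simp add: ped_family_with_even weight_add_mset)
qed

text \<open>One step passes the odd size \<open>2 * c + 1\<close> and the even size
  \<open>2 * Suc c\<close>, so the bound stays odd.\<close>

lemma ped_fps_step:
  "(1 - fps_X ^ (2 * c + 1)) * ped_fps (2 * c + 1) k = ped_fps (2 * Suc c + 1) k +
    (case k of 0 \<Rightarrow> 0 | Suc j \<Rightarrow> fps_X ^ (2 * Suc c) * ped_fps (2 * Suc c + 1) j)"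
proof -
  have "Suc (2 * c + 1) = 2 * Suc c" "Suc (2 * Suc c) = 2 * Suc c + 1" by simp_all
  then show ?thesis
    using ped_fps_odd[of "2 * c + 1" k] ped_fps_even[of "2 * Suc c" k]
    by (metis add_gr_0 dvd_triv_left even_plus_one_iff mult_2 zero_less_Suc)
qed

text \<open>By Euler's identity this is the product of \<open>1 / (1 - X^(2 * i + 1))\<close> over all \<open>i \<ge> c\<close>,
  which is \<open>(\<Prod>i>c. 1 - X^(2 * i)) / (\<Prod>i>2 * c. 1 - X^i)\<close>; this form needs neither
  division nor infinite products.\<close>

definition odd_product :: "nat \<Rightarrow> int fps" where
  "odd_product c = distinct_fps (Suc c) * (\<Prod>i=Suc c..2 * c. 1 - fps_X ^ i)"

text \<open>Euler's cancellation: the factor 1 + X^(c + 1) split off from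
  \<open>distinct_fps (Suc c)\<close> and the lowest factor 1 - X^(c + 1) of the product merge into
  1 - X^(2 c + 2), the top factor for \<open>Suc c\<close>.\<close>

lemma odd_product_Suc:
  "(1 - fps_X ^ (2 * c + 1)) * odd_product c = odd_product (Suc c)"
proof -
  let ?f = "\<lambda>i. 1 - fps_X ^ i :: int fps"
  have "(\<Prod>i=Suc c..2 * c + 1. ?f i) = ?f (2 * c + 1) * (\<Prod>i=Suc c..2 * c. ?f i)"
    by (simp add: prod.nat_ivl_Suc')
  moreover have "(\<Prod>i=Suc c..2 * c + 1. ?f i) = ?f (Suc c) * (\<Prod>i=Suc (Suc c)..2 * c + 1. ?f i)"
    by (subst prod.atLeast_Suc_atMost) auto
  moreover have "(\<Prod>i=Suc (Suc c)..2 * Suc c. ?f i) =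
      ?f (2 * Suc c) * (\<Prod>i=Suc (Suc c)..2 * c + 1. ?f i)"
    by (simp add: prod.nat_ivl_Suc')
  moreover have "?f (2 * Suc c) = (1 + fps_X ^ Suc c) * ?f (Suc c)"
    by (simp add: algebra_simps power_add[symmetric] mult_2_right del: power_Suc)
  ultimately show ?thesis
    unfolding odd_product_def distinct_fps_Suc[of "Suc c"] by (simp only: mult.assoc mult.left_commute)
qed

section \<open>Initial conditions and closed form for distinct even parts\<close>

lemma fps_X_power_dvd_weight_fps_minus_1:
  assumes "z \<in> S" "w z = 0" "\<And>x. x \<in> S \<Longrightarrow> x \<noteq> z \<Longrightarrow> c \<le> w x"
  shows "fps_X ^ c dvd weight_fps w S - 1"
proof -
  have "{x \<in> S. w x = i} = (if i = 0 then {z} else {})" if "i < c" for i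
    using assms that by force
  then show ?thesis by (simp add: fps_X_power_dvd_iff weight_fps_def)
qed

lemma fps_X_power_dvd_distinct_fps: "fps_X ^ c dvd distinct_fps c - 1"
  unfolding distinct_fps_def
proof (rule fps_X_power_dvd_weight_fps_minus_1[where z = "({}, {})"])
  fix x assume "x \<in> matched_pairs c c 0" "x \<noteq> ({}, {})"
  moreover obtain b r where "x = (b, r)" by force
  ultimately have x: "x = (b, {})" "finite b" "b \<subseteq> {c..}" and "b \<noteq> {}"
    by (auto simp: matched_pairs_def)
  then obtain y where "y \<in> b" by blast
  then have "c \<le> \<Sum>b" using le_Sum_nat[of b y] x by force
  then show "c \<le> pair_weight x" by (simp add: x pair_weight_def)
qed (auto simp: matched_pairs_def matchable_def pair_weight_def)

text \<open>Only the empty partition can have a sum below \<open>m\<close>, and having no even parts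
  it lies in the family exactly when \<open>k = 0\<close>.\<close>

lemma fps_X_power_dvd_ped_fps:
  "fps_X ^ m dvd ped_fps m k - (if k = 0 then 1 else 0)"
proof -
  have *: "m \<le> \<Sum>\<^sub># p" if "p \<in> ped_family m k" "p \<noteq> {#}" for p
  proof -
    obtain c q where "p = add_mset c q" using \<open>p \<noteq> {#}\<close> by (meson multiset_cases)
    then show ?thesis using that by (auto simp: ped_family_def)
  qed
  show ?thesis
  proof (cases "k = 0")
    case True
    then show ?thesis
      using * by (auto intro!: fps_X_power_dvd_weight_fps_minus_1[where z = "{#}"] simp: ped_family_def)
  next
    case False
    then have "{#} \<notin> ped_family m k" by (auto simp: ped_family_def)
    then show ?thesis using * False by (auto intro!: fps_X_power_dvd_weight_fps)
  qed
qed

lemma fps_X_power_dvd_prod_minus_1: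
  assumes "finite I" "\<And>i. i \<in> I \<Longrightarrow> c \<le> i"
  shows "fps_X ^ c dvd (\<Prod>i\<in>I. 1 - fps_X ^ i) - (1 :: int fps)"
  using assms
proof (induction I rule: finite_induct)
  case (insert i I)
  have "(\<Prod>i\<in>insert i I. 1 - fps_X ^ i) - (1 :: int fps) =
    ((\<Prod>i\<in>I. 1 - fps_X ^ i) - 1) - fps_X ^ i * (\<Prod>i\<in>I. 1 - fps_X ^ i)"
    using insert by (simp add: algebra_simps)
  moreover have "(fps_X :: int fps) ^ c dvd fps_X ^ i" using insert by (simp add: le_imp_power_dvd)
  ultimately show ?case using insert by (metis dvd_diff dvd_mult2 insertCI)
qed simp

lemma fps_X_power_dvd_odd_product: "fps_X ^ c dvd odd_product c - 1"
proof -
  have "odd_product c - 1 = (distinct_fps (Suc c) - 1) * (\<Prod>i=Suc c..2 * c. 1 - fps_X ^ i) +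
    ((\<Prod>i=Suc c..2 * c. 1 - fps_X ^ i) - 1)"
    by (simp add: odd_product_def algebra_simps)
  moreover have "fps_X ^ c dvd distinct_fps (Suc c) - 1"
    using fps_X_power_dvd_distinct_fps[of "Suc c"] by (rule power_le_dvd) simp
  moreover have "fps_X ^ c dvd (\<Prod>i=Suc c..2 * c. 1 - fps_X ^ i) - (1 :: int fps)"
    by (rule fps_X_power_dvd_prod_minus_1) auto
  ultimately show ?thesis by (metis dvd_add dvd_mult2)
qed

definition q2_factorial :: "nat \<Rightarrow> int fps" where
  "q2_factorial k = (\<Prod>i=1..k. 1 - fps_X ^ (2 * i))"

text \<open>The exponent is the least sum of k distinct even parts, 2 (c + 1) + ... + 2 (c + k). As
  for matched pairs, induction on \<open>k\<close> is combined with uniqueness in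
  \<open>c\<close>.\<close>

lemma ped_fps_closed_form:
  "q2_factorial k * ped_fps (2 * c + 1) k = fps_X ^ (k * (k - 1) + 2 * k * Suc c) * odd_product c"
proof (induction k arbitrary: c)
  case 0
  \<comment> \<open>Euler's identity for odd parts at least \<open>2 * c + 1\<close>: both sides
    obey the same recursion and tend to 1 as \<open>c\<close> grows.\<close>
  have "ped_fps (2 * c + 1) 0 = odd_product c"
  proof (rule fps_sequence_eqI[where u = "\<lambda>c. 1 - fps_X ^ (2 * c + 1)" and v = "\<lambda>_. 1"])
    show "fps_X ^ c dvd ped_fps (2 * c + 1) 0 - odd_product c" for c
    proof -
      have "fps_X ^ c dvd ped_fps (2 * c + 1) 0 - 1"
        using power_le_dvd[OF fps_X_power_dvd_ped_fps[of "2 * c + 1" 0], of c] by simp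
      from dvd_diff[OF this fps_X_power_dvd_odd_product[of c]] show ?thesis by simp
    qed
    show "(1 - fps_X ^ (2 * c + 1)) * (ped_fps (2 * c + 1) 0 - odd_product c) =
        1 * (ped_fps (2 * Suc c + 1) 0 - odd_product (Suc c))" for c
      unfolding right_diff_distrib ped_fps_step odd_product_Suc by simp
  qed simp
  then show ?case by (simp add: q2_factorial_def)
next
  case (Suc j)
  define A where "A c = q2_factorial (Suc j) * ped_fps (2 * c + 1) (Suc j)" for c
  \<comment> \<open>For k = \<open>Suc j\<close>, \<open>a c\<close> is the claimed monomial and
    \<open>x\<close> is its ratio between consecutive values of \<open>c\<close>.\<close>
  define a where "a c = (fps_X :: int fps) ^ (Suc j * j + 2 * Suc j * Suc c)" for c
  define x where "x = (fps_X :: int fps) ^ (2 * Suc j)"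
  have qf: "q2_factorial (Suc j) = (1 - x) * q2_factorial j"
    by (simp add: q2_factorial_def x_def)
  have aS: "a (Suc c) = x * a c" for c
    by (simp add: a_def x_def power_add[symmetric] del: power_Suc)
  have step: "(1 - fps_X ^ (2 * c + 1)) * A c = A (Suc c) + (1 - x) * (a c * odd_product (Suc c))" for c
  proof -
    have "(1 - fps_X ^ (2 * c + 1)) * A c =
      q2_factorial (Suc j) * ((1 - fps_X ^ (2 * c + 1)) * ped_fps (2 * c + 1) (Suc j))"
      by (simp only: A_def mult.left_commute)
    also have "\<dots> = A (Suc c) +
      (1 - x) * (fps_X ^ (2 * Suc c) * (q2_factorial j * ped_fps (2 * Suc c + 1) j))"
      unfolding ped_fps_step A_def qf by (simp add: algebra_simps)
    also have "fps_X ^ (2 * Suc c) * (q2_factorial j * ped_fps (2 * Suc c + 1) j) =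
      a c * odd_product (Suc c)"
    proof -
      have "2 * Suc c + (j * (j - 1) + 2 * j * Suc (Suc c)) = Suc j * j + 2 * Suc j * Suc c"
        by (cases j) (auto simp: algebra_simps)
      then show ?thesis
        unfolding Suc a_def mult.assoc[symmetric] power_add[symmetric] by simp
    qed
    finally show ?thesis .
  qed
  have "A c = a c * odd_product c"
  proof (rule fps_sequence_eqI[where u = "\<lambda>c. 1 - fps_X ^ (2 * c + 1)" and v = "\<lambda>_. 1"])
    show "fps_X ^ c dvd A c - a c * odd_product c" for c
    proof (rule dvd_diff)
      have "fps_X ^ c dvd ped_fps (2 * c + 1) (Suc j)"
        using power_le_dvd[OF fps_X_power_dvd_ped_fps[of "2 * c + 1" "Suc j"], of c] by simp
      then show "fps_X ^ c dvd A c" by (simp add: A_def)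
      show "fps_X ^ c dvd a c * odd_product c"
        unfolding a_def by (intro dvd_mult2 le_imp_power_dvd) simp
    qed
    have ao: "(1 - fps_X ^ (2 * c + 1)) * (a c * odd_product c) = a c * odd_product (Suc c)" for c
      by (metis mult.left_commute odd_product_Suc)
    \<comment> \<open>Subtracting \<open>ao\<close> from \<open>step\<close> leaves the coefficient
      \<open>- x * a c\<close> at \<open>odd_product (Suc c)\<close>, which is
      \<open>- a (Suc c)\<close> by \<open>aS\<close>.\<close>
    show "(1 - fps_X ^ (2 * c + 1)) * (A c - a c * odd_product c) =
        1 * (A (Suc c) - a (Suc c) * odd_product (Suc c))" for c
      unfolding right_diff_distrib step ao aS x_def[symmetric] by (simp add: algebra_simps)
  qed simp
  then show ?case by (simp add: A_def a_def)
qed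

section \<open>Comparison of the two series\<close>

lemma distinct_fps_1: "distinct_fps 1 = (\<Prod>i=1..k. 1 + fps_X ^ i) * distinct_fps (Suc k)"
proof (induction k)
  case (Suc k)
  then show ?case using distinct_fps_Suc[of "Suc k"] by (simp add: algebra_simps)
qed simp

text \<open>Since 1 - X^(2 i) = (1 - X^i) (1 + X^i), passing from \<open>q_factorial k\<close> to
  \<open>q2_factorial k\<close> supplies exactly the factors that extend
  \<open>distinct_fps (Suc k)\<close> to \<open>distinct_fps 1\<close>.\<close>

lemma ped_fps_eq_matched_fps: "ped_fps 1 k = matched_fps 1 1 k"
proof -
  have "q2_factorial k = (\<Prod>i=1..k. 1 + fps_X ^ i) * q_factorial k"
    unfolding q2_factorial_def q_factorial_def prod.distrib[symmetric]
    by (intro prod.cong) (auto simp: algebra_simps power_add[symmetric] mult_2_right)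
  then have "q2_factorial k * matched_fps 1 1 k =
    (\<Prod>i=1..k. 1 + fps_X ^ i) * (q_factorial k * matched_fps 1 1 k)"
    by (simp add: mult.assoc)
  also have "\<dots> = fps_X ^ (k * (k - 1) + 2 * k) * distinct_fps 1"
    using matched_fps_closed_form[of k 1] unfolding distinct_fps_1[of k] by (simp add: mult.left_commute)
  \<comment> \<open>At \<open>c = 0\<close> the finite product in \<open>odd_product\<close> is
    empty, which leaves \<open>distinct_fps 1\<close>.\<close>
  also have "\<dots> = q2_factorial k * ped_fps 1 k"
    using ped_fps_closed_form[of k 0] by (simp add: odd_product_def)
  finally have "q2_factorial k * matched_fps 1 1 k = q2_factorial k * ped_fps 1 k" .
  moreover have "fps_nth (q2_factorial k) 0 \<noteq> 0"
    by (induction k) (auto simp: q2_factorial_def)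
  ultimately show ?thesis by auto
qed

section \<open>Coefficients of the series as counts of partitions\<close>

lemma ped_eq_nth: "int (ped n k) = fps_nth (ped_fps 1 k) n"
proof -
  have "ped_partitions n k = {p \<in> ped_family 1 k. \<Sum>\<^sub># p = n}"
    by (auto simp: ped_partitions_def partitions_def ped_family_def Suc_le_eq)
  then show ?thesis by (simp add: ped_def weight_fps_def)
qed

definition colored_set :: "nat set \<times> nat set \<Rightarrow> (nat \<times> color) set" where
  "colored_set = (\<lambda>(b, r). (\<lambda>c. (c, Blue)) ` b \<union> (\<lambda>c. (c, Red)) ` r)"

lemma colored_set_mem:
  "(c, Blue) \<in> colored_set (b, r) \<longleftrightarrow> c \<in> b" "(c, Red) \<in> colored_set (b, r) \<longleftrightarrow> c \<in> r"
  by (auto simp: colored_set_def)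

lemma finite_colored_set: "finite b \<Longrightarrow> finite r \<Longrightarrow> finite (colored_set (b, r))"
  by (simp add: colored_set_def)

lemma sum_colored_set:
  assumes "finite b" "finite r"
  shows "sum fst (colored_set (b, r)) = \<Sum>b + \<Sum>r"
proof -
  have "(\<lambda>c. (c, Blue)) ` b \<inter> (\<lambda>c. (c, Red)) ` r = {}" by auto
  then show ?thesis
    using assms by (simp add: colored_set_def sum.union_disjoint sum.reindex inj_on_def)
qed

text \<open>No colored part repeats, so a multiset in \<open>\<B> n\<close> is determined by its
  support, that is, by its blue and red size sets. The bound 1 expresses positivity, and
  \<open>matchable\<close> is the second condition.\<close>

lemma B_partitions_eq:
  "B_partitions n k = (mset_set \<circ> colored_set) ` {x \<in> matched_pairs 1 1 k. pair_weight x = n}"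
  (is "_ = _ ` ?W")
proof -
  have *: "mset_set (colored_set (b, r)) \<in> B_partitions n k \<longleftrightarrow> (b, r) \<in> ?W"
    if "finite b" "finite r" for b r
  proof -
    let ?p = "mset_set (colored_set (b, r))"
    note fin = finite_colored_set[OF that]
    have mem: "(c, Blue) \<in># ?p \<longleftrightarrow> c \<in> b" "(c, Red) \<in># ?p \<longleftrightarrow> c \<in> r" for c
      using fin by (simp_all add: colored_set_mem)
    have pos: "(\<forall>c \<in># image_mset fst ?p. c > 0) \<longleftrightarrow> b \<subseteq> {1..} \<and> r \<subseteq> {1..}"
      using that by (auto simp: colored_set_def ball_Un Suc_le_eq subset_iff)
    have sum: "\<Sum>\<^sub># (image_mset fst ?p) = pair_weight (b, r)"
      using sum_colored_set[OF that] by (simp add: pair_weight_def sum_unfold_sum_mset)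
    have "filter_mset (\<lambda>x. snd x = Red) ?p = mset_set ((\<lambda>c. (c, Red)) ` r)"
      using fin by (subst filter_mset_mset_set) (auto simp: colored_set_def intro!: arg_cong[where f = mset_set])
    then have red: "size (filter_mset (\<lambda>x. snd x = Red) ?p) = card r"
      by (simp add: card_image inj_on_def)
    have count: "count ?p x \<le> 1" for x by (simp add: count_mset_set')
    show ?thesis
      unfolding B_partitions_def \<B>_def bicolored_partitions_def partitions_def mem_Collect_eq
        pos sum red mem
      using that count by (auto simp: matched_pairs_def matchable_def)
  qed
  show ?thesis
  proof
    show "B_partitions n k \<subseteq> (mset_set \<circ> colored_set) ` ?W"
    proof
      fix p assume p: "p \<in> B_partitions n k"
      let ?b = "{c. (c, Blue) \<in># p}" and ?r = "{c. (c, Red) \<in># p}"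
      have fin: "finite ?b" "finite ?r"
        by (rule finite_subset[of _ "fst ` set_mset p"], force, simp)+
      have "colored_set (?b, ?r) = set_mset p"
      proof -
        have "x \<in> colored_set (?b, ?r) \<longleftrightarrow> x \<in># p" for x
          by (cases x; cases "snd x") (auto simp: colored_set_def)
        then show ?thesis by blast
      qed
      moreover have "mset_set (set_mset p) = p"
      proof (rule multiset_eqI)
        fix x
        have "count p x \<le> 1" using p unfolding B_partitions_def \<B>_def mem_Collect_eq by blast
        then show "count (mset_set (set_mset p)) x = count p x"
          using count_greater_zero_iff[of p x] by (cases "x \<in># p") (auto simp: count_mset_set' simp del: count_greater_zero_iff)
      qed
      ultimately have eq: "p = (mset_set \<circ> colored_set) (?b, ?r)" by simp
      moreover have "(?b, ?r) \<in> ?W" by (rule *[OF fin, THEN iffD1]) (use p eq in simp)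
      ultimately show "p \<in> (mset_set \<circ> colored_set) ` ?W" by (rule image_eqI)
    qed
    show "(mset_set \<circ> colored_set) ` ?W \<subseteq> B_partitions n k"
    proof (rule image_subsetI)
      fix x assume x: "x \<in> ?W"
      obtain b r where br: "x = (b, r)" by force
      then have "finite b" "finite r" using x by (auto simp: matched_pairs_def)
      then have "mset_set (colored_set (b, r)) \<in> B_partitions n k" using * x br by blast
      then show "(mset_set \<circ> colored_set) x \<in> B_partitions n k" by (simp add: br)
    qed
  qed
qed

lemma B_eq_nth: "int (B n k) = fps_nth (matched_fps 1 1 k) n"
proof -
  let ?W = "{x \<in> matched_pairs 1 1 k. pair_weight x = n}"
  have "inj_on (mset_set \<circ> colored_set) ?W"
  proof (rule inj_onI)
    fix x y assume xy: "x \<in> ?W" "y \<in> ?W" "(mset_set \<circ> colored_set) x = (mset_set \<circ> colored_set) y"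
    obtain b r b' r' where x: "x = (b, r)" and y: "y = (b', r')" by force
    \<comment> \<open>\<open>mset_set\<close> is injective on finite sets; the color tags then
      recover both components.\<close>
    have "colored_set x = colored_set y"
      using xy unfolding x y by (auto simp: matched_pairs_def finite_colored_set dest!: mset_set_eq_iff[THEN iffD1, rotated 2])
    then have "c \<in> b \<longleftrightarrow> c \<in> b'" "c \<in> r \<longleftrightarrow> c \<in> r'" for c
      unfolding x y by (metis colored_set_mem)+
    then show "x = y" unfolding x y by blast
  qed
  then show ?thesis
    unfolding B_def B_partitions_eq weight_fps_def fps_nth_Abs_fps by (simp only: card_image)
qed

theorem theorem1p5:
  fixes n k :: nat
  shows "ped n k = B n k"
proof -
  have "int (ped n k) = int (B n k)"
    by (simp only: ped_eq_nth B_eq_nth ped_fps_eq_matched_fps)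
  then show ?thesis by simp
qed

end
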